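(* The following are true: (a) Assuming that a Hamel basis of $\mathbb{R}$ over $\mathbb{Q}$ exists, $\mathcal{C}_{\mathrm{bi}\mathbb{Q}}\subsetneq\mathcal{C}_{\mathbb{Q}}$; that is, there is a function $f:\mathbb{R}\to\mathbb{R}$ that is $\mathbb{Q}$-continuous but not bilaterally $\mathbb{Q}$-continuous. (b) $C(\tau_{\mathbb{Q}})\subsetneq LAC$; that is, there exists a function $f:\mathbb{R}\to\mathbb{R}$ that is locally almost continuous but not $\tau_{\mathbb{Q}}$-continuous.
   Context: A Hamel basis is a basis of $\mathbb{R}$ as a $\mathbb{Q}$-vector space; its existence in (a) is assumed in addition to ZF. For real $y\neq z$ put $S(y,z)=\{qy+(1-q)z: q\in\mathbb{Q}\cap[0,1]\}$. $f:\mathbb{R}\to\mathbb{R}$ is $\mathbb{Q}$-continuous at $x$ from the left if there is $\epsilon>0$ such that for all $y,z$ with $x-\epsilon<y<z\le x$ there is a continuous (in the usual sense) function $f_{y,z}:[y,z]\to\mathbb{R}$ with $f_{y,z}(t)=f(t)$ for all $t\in S(y,z)$; from the right: analogously with $x\le y<z<x+\epsilon$. $f$ is $\mathbb{Q}$-continuous if at every $x\in\mathbb{R}$ it is $\mathbb{Q}$-continuous from both sides. $f$ is bilaterally $\mathbb{Q}$-continuous if for every $x\in\mathbb{R}$ there is $\epsilon>0$ such that for all $y,z$ with $x-\epsilon\le y<z\le x+\epsilon$ such a continuous $f_{y,z}$ exists. $\mathcal{C}_{\mathbb{Q}}$ and $\mathcal{C}_{\mathrm{bi}\mathbb{Q}}$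 denote the classes of $\mathbb{Q}$-continuous and of bilaterally $\mathbb{Q}$-continuous functions $\mathbb{R}\to\mathbb{R}$. The topology $\tau_{\mathbb{Q}}$: $U\subseteq\mathbb{R}$ is $\tau_{\mathbb{Q}}$-open iff for every $a\in U$ and every real $x\neq0$ there is $\varepsilon(a,x)>0$ such that $a+qx\in U$ for all $q\in\mathbb{Q}$ with $0<q<\varepsilon(a,x)$. $C(\tau_{\mathbb{Q}})$ is the class of $\tau_{\mathbb{Q}}$-continuous functions, i.e. those continuous from $(\mathbb{R},\tau_{\mathbb{Q}})$ to $\mathbb{R}$ with the usual topology. $f$ is locally almost continuous if for every $x\in\mathbb{R}$ and every (usual) neighborhood $V$ of $f(x)$, $x\in\operatorname{Int}(\overline{f^{-1}(V)})$ (interior and closure in the usual topology); $LAC$ is the class of such functions. *)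

theory Defs
  imports "HOL-Analysis.Analysis"
begin

global_interpretation rat_real: vector_space "\<lambda>(q::rat) (x::real). of_rat q * x"
  by unfold_locales (simp_all add: algebra_simps of_rat_add of_rat_mult)

definition hamel_basis :: "real set \<Rightarrow> bool" where
  "hamel_basis H \<longleftrightarrow> rat_real.independent H \<and> rat_real.span H = UNIV"

definition rat_segment :: "real \<Rightarrow> real \<Rightarrow> real set" where
  "rat_segment y z = {q * y + (1 - q) * z | q. q \<in> \<rat> \<inter> {0..1}}"

text \<open>The extension \<^term>\<open>g\<close> is a total function, but only its restriction
  to \<^term>\<open>{y..z}\<close> is constrained.\<close>

definition has_continuous_extension :: "(real \<Rightarrow> real) \<Rightarrow> real \<Rightarrow> real \<Rightarrow> bool" where
  "has_continuous_extension f y z \<longleftrightarrow>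
     (\<exists>g :: real \<Rightarrow> real. continuous_on {y..z} g \<and> (\<forall>t\<in>rat_segment y z. g t = f t))"

definition Q_continuous_left :: "(real \<Rightarrow> real) \<Rightarrow> real \<Rightarrow> bool" where
  "Q_continuous_left f x \<longleftrightarrow>
     (\<exists>\<epsilon>>0. \<forall>y z. x - \<epsilon> < y \<and> y < z \<and> z \<le> x \<longrightarrow> has_continuous_extension f y z)"

definition Q_continuous_right :: "(real \<Rightarrow> real) \<Rightarrow> real \<Rightarrow> bool" where
  "Q_continuous_right f x \<longleftrightarrow>
     (\<exists>\<epsilon>>0. \<forall>y z. x \<le> y \<and> y < z \<and> z < x + \<epsilon> \<longrightarrow> has_continuous_extension f y z)"

definition C_Q :: "(real \<Rightarrow> real) set" where
  "C_Q = {f. \<forall>x. Q_continuous_left f x \<and> Q_continuous_right f x}"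

definition C_biQ :: "(real \<Rightarrow> real) set" where
  "C_biQ = {f. \<forall>x. \<exists>\<epsilon>>0. \<forall>y z. x - \<epsilon> \<le> y \<and> y < z \<and> z \<le> x + \<epsilon>
                 \<longrightarrow> has_continuous_extension f y z}"

definition tau_Q_open :: "real set \<Rightarrow> bool" where
  "tau_Q_open U \<longleftrightarrow>
     (\<forall>a\<in>U. \<forall>x. x \<noteq> 0 \<longrightarrow> (\<exists>\<epsilon>>0. \<forall>q\<in>\<rat>. 0 < q \<and> q < \<epsilon> \<longrightarrow> a + q * x \<in> U))"

definition tau_Q :: "real topology" where
  "tau_Q = topology tau_Q_open"

text \<open>\<^term>\<open>tau_Q\<close> is meaningful only because its open sets do form a topology.\<close>

lemma istopology_tau_Q_open: "istopology tau_Q_open"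
  unfolding istopology_def
proof (intro conjI allI impI)
  fix S T assume S: "tau_Q_open S" and T: "tau_Q_open T"
  show "tau_Q_open (S \<inter> T)"
    unfolding tau_Q_open_def
  proof (intro ballI allI impI)
    fix a x :: real assume a: "a \<in> S \<inter> T" and x: "x \<noteq> 0"
    obtain d where d: "d > 0" "\<forall>q\<in>\<rat>. 0 < q \<and> q < d \<longrightarrow> a + q * x \<in> S"
      using S a x unfolding tau_Q_open_def by blast
    obtain e where e: "e > 0" "\<forall>q\<in>\<rat>. 0 < q \<and> q < e \<longrightarrow> a + q * x \<in> T"
      using T a x unfolding tau_Q_open_def by blast
    show "\<exists>\<epsilon>>0. \<forall>q\<in>\<rat>. 0 < q \<and> q < \<epsilon> \<longrightarrow> a + q * x \<in> S \<inter> T"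
      by (rule exI[of _ "min d e"]) (use d e in auto)
  qed
next
  fix K assume K: "\<forall>S\<in>K. tau_Q_open S"
  show "tau_Q_open (\<Union>K)"
    unfolding tau_Q_open_def
  proof (intro ballI allI impI)
    fix a x :: real assume "a \<in> \<Union>K" and x: "x \<noteq> 0"
    then obtain S where S: "S \<in> K" "a \<in> S" by blast
    then obtain e where e: "e > 0" "\<forall>q\<in>\<rat>. 0 < q \<and> q < e \<longrightarrow> a + q * x \<in> S"
      using K x unfolding tau_Q_open_def by blast
    then show "\<exists>\<epsilon>>0. \<forall>q\<in>\<rat>. 0 < q \<and> q < \<epsilon> \<longrightarrow> a + q * x \<in> \<Union>K"
      using S by blast
  qed
qed

lemma openin_tau_Q: "openin tau_Q U \<longleftrightarrow> tau_Q_open U"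
  by (simp add: tau_Q_def istopology_tau_Q_open topology_inverse')

lemma topspace_tau_Q: "topspace tau_Q = UNIV"
proof -
  have "openin tau_Q UNIV"
    unfolding openin_tau_Q tau_Q_open_def by (auto intro: exI[of _ "1::real"])
  then show ?thesis using openin_subset by blast
qed

definition C_tau_Q :: "(real \<Rightarrow> real) set" where
  "C_tau_Q = {f. continuous_map tau_Q euclideanreal f}"

text \<open>A neighborhood of \<^term>\<open>p\<close> is any set having \<^term>\<open>p\<close> in its interior;
  it need not be open.\<close>

definition LAC :: "(real \<Rightarrow> real) set" where
  "LAC = {f. \<forall>x V. f x \<in> interior V \<longrightarrow> x \<in> interior (closure (f -` V))}"

end

theory Submission
  imports Defs
begin

text \<open>
  A \<open>\<rat>\<close>-linear map \<open>L\<close> is affine on every rational segment, so it has continuous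
  extensions there however wild it is as a real function. Gluing \<open>L\<close> on the right of \<open>0\<close> to the
  zero function on the left therefore gives a \<open>\<rat>\<close>-continuous function, since each one-sided
  condition sees only one of the two pieces. A segment from \<open>y < 0\<close> to \<open>z > 0\<close> sees both: its
  right part carries the chord of \<open>L\<close> through \<open>y\<close> and \<open>z\<close>, so a continuous extension requires
  this chord to pass through the origin, that is \<open>L y * z = y * L z\<close>. If this happened for
  arbitrarily short segments, \<open>L\<close> would by homogeneity be a real multiple of the identity. A
  coordinate functional of a Hamel basis is not: it is nonzero and takes only countably many values
  (\<open>ex_not_proportional_of_rational_values\<close>, \<open>cut_off_notin_C_biQ\<close>).

  For the second part, the direction \<open>1\<close> (and \<open>-1\<close>) alone shows that a \<open>\<tau>\<^sub>\<rat>\<close>-open set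
  containing \<open>a\<close> contains all \<open>a + q\<close> with \<open>q\<close> rational and small, so it is dense in an interval
  around \<open>a\<close>. The inclusion is proper because of the indicator function of \<open>\<rat>\<close>: both of its fibres
  are dense, but \<open>\<rat>\<close> is not \<open>\<tau>\<^sub>\<rat>\<close>-open, as it is left at once from \<open>0\<close> in an irrational direction.
\<close>

section \<open>Rational density\<close>

lemma closure_Rats_Int_open:
  fixes S :: "real set"
  assumes "open S"
  shows "closure (\<rat> \<inter> S) = closure S"
proof -
  have "\<exists>q\<in>\<rat>. dist q x < e" if "e > 0" for x e :: real
  proof -
    obtain q where "q \<in> \<rat>" "x < q" "q < x + e"
      using Rats_dense_in_real[of x "x + e"] \<open>e > 0\<close> by (meson less_add_same_cancel1)
    then show ?thesis by (intro bexI[of _ q]) (auto simp: dist_real_def)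
  qed
  then have "closure (\<rat> :: real set) = UNIV"
    by (auto simp: closure_approachable)
  then show ?thesis
    using closure_open_Int_superset[OF assms, of \<rat>] by (simp add: Int_commute)
qed

lemma continuous_eq_if_eq_on_Rats:
  fixes g h :: "real \<Rightarrow> real"
  assumes "continuous_on {a..b} g" "continuous_on {a..b} h" "a < b"
    and "\<And>q. q \<in> \<rat> \<Longrightarrow> a < q \<Longrightarrow> q < b \<Longrightarrow> g q = h q"
    and "t \<in> {a..b}"
  shows "g t = h t"
proof -
  have cl: "closure (\<rat> \<inter> {a<..<b}) = {a..b}"
    using closure_Rats_Int_open[of "{a<..<b}"] \<open>a < b\<close> by simp
  have "continuous_on (closure (\<rat> \<inter> {a<..<b})) (\<lambda>t. g t - h t)"
    unfolding cl by (intro continuous_on_diff assms)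
  then have "g t - h t = 0"
    by (rule continuous_constant_on_closure) (use assms cl in auto)
  then show ?thesis by simp
qed

lemma rational_multiple_in_interval:
  fixes t a b :: real
  assumes "t \<noteq> 0" "a < b"
  obtains r :: rat where "a < of_rat r * t" "of_rat r * t < b"
proof (cases "t > 0")
  case True
  then have "a / t < b / t" using assms by (simp add: divide_strict_right_mono)
  then obtain r :: rat where "a / t < of_rat r" "of_rat r < b / t"
    using of_rat_dense by blast
  then show thesis using that[of r] True by (simp add: field_simps)
next
  case False
  then have t: "t < 0" using assms by simp
  then have "b / t < a / t" using assms by (simp add: divide_strict_right_mono_neg)
  then obtain r :: rat where "b / t < of_rat r" "of_rat r < a / t"
    using of_rat_dense by blast
  then show thesis using that[of r] t by (simp add: field_simps)
qed

section \<open>Rational-linear functions on rational segments\<close>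

abbreviation rat_linear :: "(real \<Rightarrow> real) \<Rightarrow> bool" where
  "rat_linear \<equiv> Vector_Spaces.linear (\<lambda>q x. of_rat q * x) (\<lambda>q x. of_rat q * x)"

lemma rat_linear_convex_combination:
  assumes L: "rat_linear L" and q: "q \<in> \<rat>"
  shows "L (q * y + (1 - q) * z) = q * L y + (1 - q) * L z"
proof -
  interpret L: Vector_Spaces.linear "\<lambda>q x. of_rat q * x" "\<lambda>q x. of_rat q * x" L
    by (rule L)
  obtain r :: rat where r: "q = of_rat r" using q by (auto elim: Rats_cases)
  have "L (of_rat r * y + of_rat (1 - r) * z) = of_rat r * L y + of_rat (1 - r) * L z"
    by (simp only: L.add L.scale)
  then show ?thesis by (simp add: r of_rat_diff)
qed

lemma convex_combination_in_Icc:
  fixes y z q :: real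
  assumes "y \<le> z" "0 \<le> q" "q \<le> 1"
  shows "q * y + (1 - q) * z \<in> {y..z}"
proof -
  have "0 \<le> q * (z - y)" "0 \<le> (1 - q) * (z - y)" using assms by auto
  then show ?thesis by (simp add: algebra_simps)
qed

lemma rat_segment_subset: "y \<le> z \<Longrightarrow> rat_segment y z \<subseteq> {y..z}"
  unfolding rat_segment_def using convex_combination_in_Icc by auto

lemma has_continuous_extension_cong:
  assumes "y \<le> z" "\<And>t. t \<in> {y..z} \<Longrightarrow> f t = f' t"
  shows "has_continuous_extension f y z \<longleftrightarrow> has_continuous_extension f' y z"
  using rat_segment_subset[OF assms(1)] assms(2)
  unfolding has_continuous_extension_def by (metis subsetD)

lemma has_continuous_extension_rat_linear:
  assumes L: "rat_linear L" and "y < z"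
  shows "has_continuous_extension L y z"
  unfolding has_continuous_extension_def
proof (intro exI conjI ballI)
  let ?g = "\<lambda>t. L y + (t - y) / (z - y) * (L z - L y)"
  show "continuous_on {y..z} ?g"
    using \<open>y < z\<close> by (intro continuous_intros) auto
  fix t assume "t \<in> rat_segment y z"
  then obtain q where q: "q \<in> \<rat>" "t = q * y + (1 - q) * z"
    by (auto simp: rat_segment_def)
  have "(t - y) / (z - y) = 1 - q"
    using \<open>y < z\<close> by (simp add: q(2) field_simps)
  then have "?g t = L y + (1 - q) * (L z - L y)"
    by (simp only:)
  then show "?g t = L t"
    unfolding q(2) rat_linear_convex_combination[OF L q(1)] by (simp add: algebra_simps)
qed

lemma C_biQ_subset_C_Q: "C_biQ \<subseteq> C_Q"
proof
  fix f assume f: "f \<in> C_biQ"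
  have "Q_continuous_left f x \<and> Q_continuous_right f x" for x
  proof -
    obtain e where "e > 0" and
      "\<And>y z. x - e \<le> y \<Longrightarrow> y < z \<Longrightarrow> z \<le> x + e \<Longrightarrow> has_continuous_extension f y z"
      using f unfolding C_biQ_def by blast
    then show ?thesis
      unfolding Q_continuous_left_def Q_continuous_right_def
      by (intro conjI exI[of _ e]) auto
  qed
  then show "f \<in> C_Q" by (simp add: C_Q_def)
qed

section \<open>Cutting off a rational-linear function at the origin\<close>

definition cut_off :: "(real \<Rightarrow> real) \<Rightarrow> real \<Rightarrow> real" where
  "cut_off L t = (if 0 \<le> t then L t else 0)"

text \<open>The value \<open>L 0 = 0\<close> belongs to both pieces, so that segments ending at \<open>0\<close> stay
  within a single piece.\<close>

lemma has_continuous_extension_cut_off: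
  assumes L: "rat_linear L" and "y < z" and side: "0 \<le> y \<or> z \<le> 0"
  shows "has_continuous_extension (cut_off L) y z"
proof -
  interpret L: Vector_Spaces.linear "\<lambda>q x. of_rat q * x" "\<lambda>q x. of_rat q * x" L
    by (rule L)
  have "L 0 = 0" by (rule L.zero)
  consider "0 \<le> y" | "z \<le> 0" using side by blast
  then show ?thesis
  proof cases
    case 1
    then have "has_continuous_extension (cut_off L) y z \<longleftrightarrow> has_continuous_extension L y z"
      using \<open>y < z\<close> by (intro has_continuous_extension_cong) (auto simp: cut_off_def)
    then show ?thesis using has_continuous_extension_rat_linear[OF L \<open>y < z\<close>] by simp
  next
    case 2
    have "cut_off L t = 0" if "t \<in> {y..z}" for t
      using that 2 \<open>L 0 = 0\<close> by (cases "t = 0") (auto simp: cut_off_def)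
    then have "has_continuous_extension (cut_off L) y z
        \<longleftrightarrow> has_continuous_extension (\<lambda>_. 0) y z"
      using \<open>y < z\<close> by (intro has_continuous_extension_cong) auto
    moreover have "has_continuous_extension (\<lambda>_. 0) y z"
      unfolding has_continuous_extension_def by (intro exI[of _ "\<lambda>_. 0"]) auto
    ultimately show ?thesis by simp
  qed
qed

lemma cut_off_in_C_Q:
  assumes "rat_linear L"
  shows "cut_off L \<in> C_Q"
proof -
  have "Q_continuous_left (cut_off L) x" for x
    unfolding Q_continuous_left_def
    \<comment> \<open>a radius at most \<open>x\<close> keeps the segments inside \<open>{0..}\<close> when \<open>x > 0\<close>\<close>
    by (intro exI[of _ "if x > 0 then x else 1"])
      (auto intro: has_continuous_extension_cut_off[OF assms])
  moreover have "Q_continuous_right (cut_off L) x" for x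
    unfolding Q_continuous_right_def
    by (intro exI[of _ "if x < 0 then - x else 1"])
      (auto intro: has_continuous_extension_cut_off[OF assms])
  ultimately show ?thesis by (simp add: C_Q_def)
qed

text \<open>Parametrise the segment by \<open>q \<mapsto> q * y + (1 - q) * z\<close>; it crosses \<open>0\<close> at
  \<open>c = z / (z - y)\<close>. At rational parameters the extension is \<open>q * L y + (1 - q) * L z\<close> before \<open>c\<close>
  and \<open>0\<close> after it, and by continuity both values have to agree at \<open>c\<close>, whether or not
  \<open>c\<close> is itself rational.\<close>

lemma cut_off_extension_imp_proportional:
  assumes L: "rat_linear L" and "y < 0" "0 < z"
    and ext: "has_continuous_extension (cut_off L) y z"
  shows "L y * z = y * L z"
proof -
  obtain g where g: "continuous_on {y..z} g"
    and g_eq: "\<And>t. t \<in> rat_segment y z \<Longrightarrow> g t = cut_off L t"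
    using ext unfolding has_continuous_extension_def by blast
  define c where "c = z / (z - y)"
  have c: "0 < c" "c < 1" using assms by (auto simp: c_def field_simps)
  define p where "p q = q * y + (1 - q) * z" for q
  have p: "p q \<in> {y..z}" if "q \<in> {0..1}" for q
    using that assms convex_combination_in_Icc[of y z q] unfolding p_def by auto
  have cont: "continuous_on {0..1} (\<lambda>q. g (p q))"
    by (rule continuous_on_compose2[OF g])
      (use p in \<open>auto simp: p_def intro!: continuous_intros\<close>)
  have gp: "g (p q) = cut_off L (p q)" if "q \<in> \<rat>" "0 \<le> q" "q \<le> 1" for q
    using that by (intro g_eq) (auto simp: rat_segment_def p_def)
  have sgn: "0 \<le> p q \<longleftrightarrow> q \<le> c" for q
    using assms by (simp add: p_def c_def field_simps)
  have "g (p c) = c * L y + (1 - c) * L z"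
  proof (rule continuous_eq_if_eq_on_Rats[of 0 c "\<lambda>q. g (p q)"])
    show "continuous_on {0..c} (\<lambda>q. g (p q))"
      by (rule continuous_on_subset[OF cont]) (use c in auto)
    show "g (p q) = q * L y + (1 - q) * L z" if "q \<in> \<rat>" "0 < q" "q < c" for q
      using that c gp[of q] sgn[of q] rat_linear_convex_combination[OF L, of q y z]
      by (simp add: cut_off_def p_def)
  qed (use c in \<open>auto intro!: continuous_intros\<close>)
  moreover have "g (p c) = 0"
  proof (rule continuous_eq_if_eq_on_Rats[of c 1 "\<lambda>q. g (p q)" "\<lambda>_. 0"])
    show "continuous_on {c..1} (\<lambda>q. g (p q))"
      by (rule continuous_on_subset[OF cont]) (use c in auto)
    show "g (p q) = 0" if "q \<in> \<rat>" "c < q" "q < 1" for q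
      using that c gp[of q] sgn[of q] by (simp add: cut_off_def)
  qed (use c in auto)
  moreover have "1 - c = - y / (z - y)"
    using assms by (simp add: c_def field_simps)
  ultimately have "(z * L y - y * L z) / (z - y) = 0"
    by (simp add: c_def diff_divide_distrib)
  then show ?thesis
    using assms by (simp add: mult.commute)
qed

lemma cut_off_notin_C_biQ:
  assumes L: "rat_linear L" and not_prop: "L u * v \<noteq> u * L v"
  shows "cut_off L \<notin> C_biQ"
proof
  interpret L: Vector_Spaces.linear "\<lambda>q x. of_rat q * x" "\<lambda>q x. of_rat q * x" L
    by (rule L)
  assume "cut_off L \<in> C_biQ"
  then obtain e where "e > 0" and e: "\<And>y z. 0 - e \<le> y \<Longrightarrow> y < z \<Longrightarrow> z \<le> 0 + e
      \<Longrightarrow> has_continuous_extension (cut_off L) y z"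
    unfolding C_biQ_def by blast
  have "u \<noteq> 0" "v \<noteq> 0" using not_prop L.zero by auto
  then obtain r s :: rat where r: "- e < of_rat r * u" "of_rat r * u < 0"
    and s: "0 < of_rat s * v" "of_rat s * v < e"
    using rational_multiple_in_interval[of u "- e" 0] rational_multiple_in_interval[of v 0 e]
      \<open>e > 0\<close> by (metis neg_less_0_iff_less)
  have "L (of_rat r * u) * (of_rat s * v) = (of_rat r * u) * L (of_rat s * v)"
    using r s by (intro cut_off_extension_imp_proportional[OF L] e) auto
  then have "of_rat r * of_rat s * (L u * v) = of_rat r * of_rat s * (u * L v)"
    unfolding L.scale by (simp only: mult_ac)
  moreover have "r \<noteq> 0" "s \<noteq> 0" using r s by auto
  ultimately show False using not_prop by simp
qed

text \<open>Otherwise every real \<open>v\<close> would equal \<open>(u / L u) * L v\<close>, and there would be only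
  countably many reals.\<close>

lemma ex_not_proportional_of_rational_values:
  fixes L :: "real \<Rightarrow> real"
  assumes "range L \<subseteq> \<rat>" "L u \<noteq> 0"
  obtains v where "L u * v \<noteq> u * L v"
proof -
  have False if "\<And>v. L u * v = u * L v"
  proof -
    have "v \<in> (\<lambda>q. u / L u * q) ` \<rat>" for v
      using that[of v] assms by (intro image_eqI[of _ _ "L v"]) (auto simp: field_simps)
    then have "(UNIV :: real set) \<subseteq> (\<lambda>q. u / L u * q) ` \<rat>" by blast
    then have "countable (UNIV :: real set)"
      by (rule countable_subset) (intro countable_image countable_rat)
    then show False using uncountable_UNIV_real by blast
  qed
  then show thesis using that by blast
qed

lemma hamel_basis_imp_rational_functional:
  assumes "hamel_basis H"
  obtains L u where "rat_linear L" "range L \<subseteq> \<rat>" "L u \<noteq> 0"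
proof -
  have ind: "rat_real.independent H" and span: "rat_real.span H = UNIV"
    using assms by (auto simp: hamel_basis_def)
  obtain b where b: "b \<in> H"
    using span rat_real.span_empty by (metis UNIV_I all_not_in_conv singletonD zero_neq_one)
  define L :: "real \<Rightarrow> real" where "L t = of_rat (rat_real.representation H t b)" for t
  show thesis
  proof (rule that)
    show "rat_linear L"
      by unfold_locales
        (simp_all add: L_def rat_real.representation_add[OF ind]
          rat_real.representation_scale[OF ind] span of_rat_add of_rat_mult distrib_left)
    show "range L \<subseteq> \<rat>" by (auto simp: L_def)
    show "L b \<noteq> 0" by (simp add: L_def rat_real.representation_basis[OF ind b])
  qed
qed

section \<open>The rational topology and local almost continuity\<close>

lemma tau_Q_open_imp_interior_closure:
  assumes U: "tau_Q_open U" and a: "a \<in> U"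
  shows "a \<in> interior (closure U)"
proof -
  have "\<exists>\<epsilon>>0. \<forall>q\<in>\<rat>. 0 < q \<and> q < \<epsilon> \<longrightarrow> a + q * x \<in> U" if "x \<noteq> 0" for x
    using U a that unfolding tau_Q_open_def by blast
  from this[of 1] this[of "-1"] obtain d e
    where d: "d > 0" "\<And>q. q \<in> \<rat> \<Longrightarrow> 0 < q \<Longrightarrow> q < d \<Longrightarrow> a + q \<in> U"
      and e: "e > 0" "\<And>q. q \<in> \<rat> \<Longrightarrow> 0 < q \<Longrightarrow> q < e \<Longrightarrow> a - q \<in> U"
    by auto
  define I where "I = {- min d e<..<min d e}"
  have "a + q \<in> U" if q: "q \<in> \<rat> \<inter> I" for q
    using d(2)[of q] e(2)[of "- q"] q a by (cases q "0::real" rule: linorder_cases) (auto simp: I_def)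
  then have "closure ((+) a ` (\<rat> \<inter> I)) \<subseteq> closure U"
    by (intro closure_mono) auto
  moreover have "I \<subseteq> closure (\<rat> \<inter> I)"
    using closure_Rats_Int_open[of I] closure_subset[of I] by (simp add: I_def)
  ultimately have "(+) a ` I \<subseteq> closure U"
    by (auto simp: closure_translation)
  moreover have "open ((+) a ` I)" by (simp add: I_def open_translation)
  moreover have "a \<in> (+) a ` I" using d(1) e(1) by (auto simp: I_def image_iff)
  ultimately show ?thesis by (meson interiorI)
qed

lemma C_tau_Q_subset_LAC: "C_tau_Q \<subseteq> LAC"
proof
  fix f assume "f \<in> C_tau_Q"
  then have f: "continuous_map tau_Q euclideanreal f" by (simp add: C_tau_Q_def)
  have "x \<in> interior (closure (f -` V))" if "f x \<in> interior V" for x V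
  proof -
    have "openin tau_Q (f -` interior V)"
      using openin_continuous_map_preimage[OF f, of "interior V"]
      by (simp add: topspace_tau_Q vimage_def)
    then have "x \<in> interior (closure (f -` interior V))"
      using that by (intro tau_Q_open_imp_interior_closure) (simp_all add: openin_tau_Q)
    moreover have "closure (f -` interior V) \<subseteq> closure (f -` V)"
      using interior_subset by (intro closure_mono) blast
    ultimately show ?thesis using interior_mono by blast
  qed
  then show "f \<in> LAC" by (simp add: LAC_def)
qed

lemma indicator_Rats_in_LAC: "indicator \<rat> \<in> LAC"
proof -
  have rats: "closure (\<rat> :: real set) = UNIV"
    using closure_Rats_Int_open[of UNIV] by simp
  have irrats: "closure (- \<rat> :: real set) = UNIV"
  proof -
    have "\<exists>y\<in>- \<rat>. dist y x < e" if "e > 0" for x e :: real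
    proof -
      obtain y where "y \<in> {x<..<x + e}" "y \<notin> \<rat>"
        using real_interval_avoid_countable_set[OF _ countable_rat, of x "x + e"] \<open>e > 0\<close>
        by (meson less_add_same_cancel1)
      then show ?thesis by (intro bexI[of _ y]) (auto simp: dist_real_def)
    qed
    then show ?thesis by (auto simp: closure_approachable)
  qed
  have "closure (indicator \<rat> -` V) = (UNIV :: real set)"
    if "indicator \<rat> x \<in> interior V" for x :: real and V :: "real set"
  proof -
    have V: "indicator \<rat> x \<in> V" using that interior_subset by blast
    show ?thesis
    proof (cases "x \<in> \<rat>")
      case True
      then have "\<rat> \<subseteq> indicator \<rat> -` V" using V by auto
      then show ?thesis using closure_mono rats by blast
    next
      case False
      then have "- \<rat> \<subseteq> indicator \<rat> -` V" using V by auto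
      then show ?thesis using closure_mono irrats by blast
    qed
  qed
  then show ?thesis by (simp add: LAC_def)
qed

lemma indicator_Rats_notin_C_tau_Q: "indicator \<rat> \<notin> C_tau_Q"
proof
  assume "indicator \<rat> \<in> C_tau_Q"
  then have f: "continuous_map tau_Q euclideanreal (indicator \<rat>)" by (simp add: C_tau_Q_def)
  have "{x. indicator \<rat> x \<in> {0::real<..}} = (\<rat> :: real set)"
    by (auto simp: indicator_def)
  then have "tau_Q_open \<rat>"
    using openin_continuous_map_preimage[OF f, of "{0<..}"]
    by (simp add: topspace_tau_Q openin_tau_Q)
  moreover obtain x :: real where x: "x \<notin> \<rat>"
    using real_interval_avoid_countable_set[of 0 1 \<rat>] countable_rat by auto
  moreover have "x \<noteq> 0" using x by auto
  ultimately obtain e where "e > 0"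
    and e: "\<And>q. q \<in> \<rat> \<Longrightarrow> 0 < q \<Longrightarrow> q < e \<Longrightarrow> 0 + q * x \<in> \<rat>"
    unfolding tau_Q_open_def by (metis Rats_0)
  obtain q where q: "q \<in> \<rat>" "0 < q" "q < e" using Rats_dense_in_real \<open>e > 0\<close> by blast
  then have "q * x / q \<in> \<rat>" using e[of q] by (intro Rats_divide) auto
  then show False using x q by simp
qed

theorem theorem9p15:
  shows "((\<exists>H. hamel_basis H) \<longrightarrow> C_biQ \<subset> C_Q) \<and> C_tau_Q \<subset> LAC"
proof (intro conjI impI)
  assume "\<exists>H. hamel_basis H"
  then obtain L u where L: "rat_linear L" "range L \<subseteq> \<rat>" "L u \<noteq> 0"
    by (auto elim: hamel_basis_imp_rational_functional)
  obtain v where "L u * v \<noteq> u * L v"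
    using ex_not_proportional_of_rational_values[OF L(2,3)] .
  then show "C_biQ \<subset> C_Q"
    using C_biQ_subset_C_Q cut_off_in_C_Q[OF L(1)] cut_off_notin_C_biQ[OF L(1)] by blast
next
  show "C_tau_Q \<subset> LAC"
    using C_tau_Q_subset_LAC indicator_Rats_in_LAC indicator_Rats_notin_C_tau_Q by blast
qed

end
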